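(* Assume that the eavesdropper channel matrices $\boldsymbol H_{K+1,\ell}\in\mathbb C^{N_e\times M}$, $\ell=1,\dots,K$, have full rank $\min(N_e,M)$ (which holds almost surely for i.i.d. complex Gaussian entries). Then the feasible condition of the ZFWS interference alignment scheme (feasibility as defined in the context) is $$M-d\ge N_e\quad\text{and}\quad N\ge Kd .$$
   Context: There are $K$ transmitter-receiver pairs, $\mathcal K=\{1,\dots,K\}$, and one eavesdropper (indexed $K+1$). Each transmitter has $M$ antennas, each receiver $N$ antennas, the eavesdropper $N_e$ antennas, and $d\ge1$ data streams are sent between each pair; $K,M,N,N_e,d$ are positive integers with $d\le\min(M,N)$, and $P_t>0$. The channel matrices are $\boldsymbol H_{k,\ell}\in\mathbb C^{N\times M}$ ($k,\ell\in\mathcal K$) and $\boldsymbol H_{K+1,\ell}\in\mathbb C^{N_e\times M}$ ($\ell\in\mathcal K$), with i.i.d. complex Gaussian entries. The ZFWS (zero-forcing wiretapped signal) scheme seeks precoders $\boldsymbol F_\ell\in\mathbb C^{M\times d}$ with $\boldsymbol F_\ell^H\boldsymbol F_\ell=\frac{P_t}{d}\boldsymbol I_d$ satisfying the zero-information-leakage constraint $$\boldsymbol H_{K+1,\ell}\boldsymbol F_\ell=\boldsymbol 0,\qquad \ell\in\mathcal K, \tag{a}$$ of the form $\boldsymbol F_\ell=\boldsymbol\Delta_\ell\boldsymbol P_\ell$, where $\boldsymbol\Delta_\ell\in\mathbb C^{M\times d}$ is a fixed matrix with orthonormal columns in the null space of $\boldsymbol H_{K+1,\ell}$ (the last $d$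 right singular vectors of $\boldsymbol H_{K+1,\ell}$, singular values in decreasing order) and $\boldsymbol P_\ell\in\mathbb C^{d\times d}$, together with receive subspace matrices $\boldsymbol W_k\in\mathbb C^{N\times d}$, such that $$\boldsymbol W_k^H\boldsymbol H_{k,\ell}\boldsymbol F_\ell=\boldsymbol 0,\qquad k,\ell\in\mathcal K,\ \ell\ne k. \tag{b}$$ Feasibility. The scheme is called feasible if (i) precoders satisfying (a) and $\boldsymbol F_\ell^H\boldsymbol F_\ell=\frac{P_t}{d}\boldsymbol I_d$ exist for all $\ell\in\mathcal K$, and (ii) the system (b) is proper, meaning $N_v\ge N_{eq}$, where $N_{eq}$ and $N_v$ are the numbers of scalar equations and of variables in (b). Here a $p\times q$ matrix equation counts as $pq$ equations, so $N_{eq}=K(K-1)d^2$; a subspace matrix in $\mathbb C^{m\times n}$ counts as $n(m-n)$ variables, so each $\boldsymbol W_k$ contributes $(N-d)d$ while the square matrices $\boldsymbol P_\ell$ contribute none (superfluous variables), giving $N_v=K(N-d)d$. *)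

theory Defs
  imports
    Complex_Main
    "Jordan_Normal_Form.Schur_Decomposition"
    "Jordan_Normal_Form.DL_Rank"
begin

definition unitary_mat :: "nat \<Rightarrow> complex mat \<Rightarrow> bool" where
  "unitary_mat n U \<longleftrightarrow>
     U \<in> carrier_mat n n \<and> mat_adjoint U * U = 1\<^sub>m n \<and> U * mat_adjoint U = 1\<^sub>m n"

definition is_svd ::
  "complex mat \<Rightarrow> complex mat \<Rightarrow> (nat \<Rightarrow> real) \<Rightarrow> complex mat \<Rightarrow> bool" where
  "is_svd A U \<sigma> V \<longleftrightarrow>
     unitary_mat (dim_row A) U \<and> unitary_mat (dim_col A) V \<and>
     (\<forall>i < min (dim_row A) (dim_col A). 0 \<le> \<sigma> i) \<and>
     (\<forall>i j. i \<le> j \<and> j < min (dim_row A) (dim_col A) \<longrightarrow> \<sigma> j \<le> \<sigma> i) \<and>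
     A = U * mat (dim_row A) (dim_col A)
               (\<lambda>(i, j). if i = j then complex_of_real (\<sigma> i) else 0) * mat_adjoint V"

text \<open>A singular value decomposition is not unique, so this is a relation: the columns of
  \<open>D\<close> are the last \<open>d\<close> right singular vectors in some decomposition of \<open>A\<close>.  They need not
  lie in the null space of \<open>A\<close>; whether they do is part of the feasibility question.\<close>

definition last_right_singular_vectors :: "nat \<Rightarrow> complex mat \<Rightarrow> complex mat \<Rightarrow> bool" where
  "last_right_singular_vectors d A D \<longleftrightarrow>
     (\<exists>U \<sigma> V. is_svd A U \<sigma> V \<and>
        D = mat (dim_col A) d (\<lambda>(i, j). V $$ (i, dim_col A - d + j)))"

text \<open>Channels are given by \<open>H :: nat \<Rightarrow> nat \<Rightarrow> complex mat\<close>: \<open>H k l\<close> is the channel from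
  transmitter \<open>l\<close> to receiver \<open>k\<close>, with users \<open>{1..K}\<close> and eavesdropper index \<open>K + 1\<close>.\<close>

definition zfws_precoders ::
  "nat \<Rightarrow> nat \<Rightarrow> nat \<Rightarrow> nat \<Rightarrow> real \<Rightarrow> (nat \<Rightarrow> nat \<Rightarrow> complex mat) \<Rightarrow>
   (nat \<Rightarrow> complex mat) \<Rightarrow> (nat \<Rightarrow> complex mat) \<Rightarrow> bool" where
  "zfws_precoders K M Ne d Pt H \<Delta> F \<longleftrightarrow>
     (\<forall>l \<in> {1..K}.
        F l \<in> carrier_mat M d \<and>
        mat_adjoint (F l) * F l = complex_of_real (Pt / real d) \<cdot>\<^sub>m 1\<^sub>m d \<and>
        H (K + 1) l * F l = 0\<^sub>m Ne d \<and>
        (\<exists>P \<in> carrier_mat d d. F l = \<Delta> l * P))"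

definition matrix_equation_count :: "nat \<Rightarrow> nat \<Rightarrow> nat" where
  "matrix_equation_count p q = p * q"

definition subspace_variable_count :: "nat \<Rightarrow> nat \<Rightarrow> nat" where
  "subspace_variable_count m n = n * (m - n)"

text \<open>The alignment system consists of the equations \<open>W\<^sub>k\<^sup>H H\<^sub>k\<^sub>l F\<^sub>l = 0\<close>, each of size
  \<open>d \<times> d\<close>, one for every ordered pair of distinct users.  Its unknowns are the subspaces of
  the \<open>N \<times> d\<close> matrices \<open>W\<^sub>k\<close> and of the \<open>d \<times> d\<close> matrices \<open>P\<^sub>l\<close>, where \<open>F\<^sub>l = \<Delta>\<^sub>l P\<^sub>l\<close>; the
  latter contribute no variables.\<close>

definition num_alignment_equations :: "nat \<Rightarrow> nat \<Rightarrow> nat" where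
  "num_alignment_equations K d =
     (\<Sum>k \<in> {1..K}. \<Sum>l \<in> {1..K} - {k}. matrix_equation_count d d)"

definition num_alignment_variables :: "nat \<Rightarrow> nat \<Rightarrow> nat \<Rightarrow> nat" where
  "num_alignment_variables K N d =
     (\<Sum>k \<in> {1..K}. subspace_variable_count N d) + (\<Sum>l \<in> {1..K}. subspace_variable_count d d)"

definition alignment_proper :: "nat \<Rightarrow> nat \<Rightarrow> nat \<Rightarrow> bool" where
  "alignment_proper K N d \<longleftrightarrow> num_alignment_variables K N d \<ge> num_alignment_equations K d"

definition zfws_feasible ::
  "nat \<Rightarrow> nat \<Rightarrow> nat \<Rightarrow> nat \<Rightarrow> nat \<Rightarrow> real \<Rightarrow> (nat \<Rightarrow> nat \<Rightarrow> complex mat) \<Rightarrow>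
   (nat \<Rightarrow> complex mat) \<Rightarrow> bool" where
  "zfws_feasible K M N Ne d Pt H \<Delta> \<longleftrightarrow>
     (\<exists>F. zfws_precoders K M Ne d Pt H \<Delta> F) \<and> alignment_proper K N d"

end

theory Submission
  imports Defs
begin

text \<open>Write \<open>A = U S V\<^sup>H\<close> for an eavesdropper channel and \<open>D\<close> for its last \<open>d\<close> right singular
  vectors.  If \<open>F = D P\<close> satisfies \<open>F\<^sup>H F = c I\<close> with \<open>c \<noteq> 0\<close>, then the square matrix \<open>P\<close> is
  invertible, so \<open>A F = 0\<close> is equivalent to \<open>A D = 0\<close>, that is, to the vanishing of the last \<open>d\<close>
  columns of \<open>S\<close>.  If \<open>N\<^sub>e \<le> M - d\<close>, these columns lie off the diagonal of \<open>S\<close> and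
  \<open>F = \<surd>c D\<close> is a precoder.  If \<open>N\<^sub>e > M - d\<close>, their vanishing leaves \<open>A\<close> with rank at most
  \<open>M - d < min N\<^sub>e M\<close>.  Properness amounts to \<open>K (K - 1) d\<^sup>2 \<le> K (N - d) d\<close>.\<close>

section \<open>Matrix algebra: rank bounds, adjoints and column selection\<close>

text \<open>Since \<open>(B * C) x = B (C x)\<close>, the column space of \<open>B * C\<close> lies
  in that of \<open>B\<close>, which is spanned by \<open>r\<close> columns.\<close>

lemma rank_mult_le_inner_dim:
  fixes B C :: "'a :: field mat"
  assumes B: "B \<in> carrier_mat n r" and C: "C \<in> carrier_mat r m"
  shows "vec_space.rank n (B * C) \<le> r"
proof -
  interpret vec_space "TYPE('a)" n .
  have BC: "B * C \<in> carrier_mat n m"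
    using B C by simp
  have sub: "span (set (cols (B * C))) \<subseteq> span (set (cols B))"
  proof -
    have "y \<in> col_space B" if y: "y \<in> col_space (B * C)" for y
    proof -
      obtain x where "x \<in> carrier_vec m" "(B * C) *\<^sub>v x = y" "y \<in> carrier_vec n"
        using y B C unfolding col_space_eq[OF BC] by auto
      moreover from this have "B *\<^sub>v (C *\<^sub>v x) = y"
        using B C by simp
      ultimately show ?thesis
        using B C unfolding col_space_eq[OF B] by auto
    qed
    then show ?thesis
      unfolding col_space_def by blast
  qed
  have S1: "VectorSpace.subspace class_ring (span (set (cols (B * C)))) V"
    using BC by (metis cols_dim carrier_matD(1) span_is_subspace)
  have S2: "VectorSpace.subspace class_ring (span (set (cols B))) V"
    using B by (metis cols_dim carrier_matD(1) span_is_subspace)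
  have "rank (B * C) \<le> rank B"
    unfolding rank_def
    using vectorspace.subspace_dim[OF subspace_is_vs[OF S2] nested_subspaces[OF S2 S1 sub]]
      fin_dim_span_cols[OF B] fin_dim_span_cols[OF BC] by simp
  also have "\<dots> \<le> r"
    using B by (rule rank_le_nc)
  finally show ?thesis .
qed

lemma mat_adjoint_carrier [simp]:
  "A \<in> carrier_mat n m \<Longrightarrow> mat_adjoint A \<in> carrier_mat m n"
  by (intro carrier_matI) (simp_all add: mat_adjoint_def)

lemma mat_adjoint_smult:
  fixes a :: complex
  assumes "A \<in> carrier_mat n m"
  shows "mat_adjoint (a \<cdot>\<^sub>m A) = cnj a \<cdot>\<^sub>m mat_adjoint A"
  using assms by (intro eq_matI) (auto simp: mat_adjoint_def mat_of_rows_def)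

text \<open>Encodes the choice of the last \<open>d\<close> columns as right multiplication, so that
  associativity and cancellation of unitary factors apply to it.\<close>

definition tail_selector :: "nat \<Rightarrow> nat \<Rightarrow> complex mat" where
  "tail_selector m d = mat m d (\<lambda>(i, j). if i = m - d + j then 1 else 0)"

lemma tail_selector_carrier [simp]: "tail_selector m d \<in> carrier_mat m d"
  by (simp add: tail_selector_def)

lemma mult_tail_selector:
  assumes "A \<in> carrier_mat n m" "d \<le> m"
  shows "A * tail_selector m d = mat n d (\<lambda>(i, j). A $$ (i, m - d + j))"
proof (rule eq_matI)
  fix i j assume "i < dim_row (mat n d (\<lambda>(i, j). A $$ (i, m - d + j)))"
    "j < dim_col (mat n d (\<lambda>(i, j). A $$ (i, m - d + j)))"
  then have ij: "i < n" "j < d" by auto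
  have "(A * tail_selector m d) $$ (i, j)
      = (\<Sum>k = 0..<m. A $$ (i, k) * (if k = m - d + j then 1 else 0))"
    using assms ij by (simp add: tail_selector_def scalar_prod_def)
  also have "\<dots> = A $$ (i, m - d + j)"
    using assms(2) ij by (simp add: if_distrib cong: if_cong)
  finally show "(A * tail_selector m d) $$ (i, j) = mat n d (\<lambda>(i, j). A $$ (i, m - d + j)) $$ (i, j)"
    using ij by simp
qed (use assms in \<open>auto simp: tail_selector_def\<close>)

text \<open>The Gram matrix of the last \<open>d\<close> columns is the lower right \<open>d\<close>
  by \<open>d\<close> block of \<open>mat_adjoint V * V\<close>, an identity matrix.\<close>

lemma mat_adjoint_tail_columns:
  assumes V: "unitary_mat m V" and "d \<le> m"
  shows "mat_adjoint (V * tail_selector m d) * (V * tail_selector m d) = 1\<^sub>m d"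
proof (rule eq_matI)
  have Vc: "V \<in> carrier_mat m m" and VV: "mat_adjoint V * V = 1\<^sub>m m"
    using V by (auto simp: unitary_mat_def)
  fix i j assume "i < dim_row (1\<^sub>m d :: complex mat)" "j < dim_col (1\<^sub>m d :: complex mat)"
  then have ij: "i < d" "j < d" by auto
  have "(mat_adjoint (V * tail_selector m d) * (V * tail_selector m d)) $$ (i, j)
      = (mat_adjoint V * V) $$ (m - d + i, m - d + j)"
    using Vc ij \<open>d \<le> m\<close>
    by (simp add: mult_tail_selector mat_adjoint_def mat_of_rows_def scalar_prod_def)
  then show "(mat_adjoint (V * tail_selector m d) * (V * tail_selector m d)) $$ (i, j) = 1\<^sub>m d $$ (i, j)"
    using ij \<open>d \<le> m\<close> by (auto simp: VV)
qed (auto simp: mat_adjoint_def tail_selector_def)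

text \<open>The zero columns let \<open>S\<close> factor through dimension \<open>r\<close>:
  \<open>S1\<close> holds its first \<open>r\<close> columns and \<open>J\<close> is an identity
  block padded with zero columns. The product then has inner dimension \<open>r\<close>.\<close>

lemma rank_mult_zero_tail_le:
  fixes U S X :: "complex mat"
  assumes U: "U \<in> carrier_mat n n" and S: "S \<in> carrier_mat n m" and X: "X \<in> carrier_mat m p"
    and "r \<le> m" and zero: "\<And>i j. i < n \<Longrightarrow> r \<le> j \<Longrightarrow> j < m \<Longrightarrow> S $$ (i, j) = 0"
  shows "vec_space.rank n (U * S * X) \<le> r"
proof -
  define S1 where "S1 = mat n r (\<lambda>(i, j). S $$ (i, j))"
  define J where "J = mat r m (\<lambda>(i, j). if i = j then 1 else 0 :: complex)"
  have c: "S1 \<in> carrier_mat n r" "J \<in> carrier_mat r m"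
    by (auto simp: S1_def J_def)
  have "S = S1 * J"
  proof (rule eq_matI)
    fix i j assume "i < dim_row (S1 * J)" "j < dim_col (S1 * J)"
    then have ij: "i < n" "j < m" using c by auto
    have "(S1 * J) $$ (i, j) = (\<Sum>k = 0..<r. S $$ (i, k) * (if k = j then 1 else 0))"
      using ij by (simp add: S1_def J_def scalar_prod_def)
    \<comment> \<open>For \<open>j < r\<close> one summand survives; for \<open>r \<le> j\<close>
      the index \<open>k\<close> never meets \<open>j\<close>, and the entry vanishes by
      \<open>zero\<close>.\<close>
    also have "\<dots> = S $$ (i, j)"
      using ij zero[of i j] by (simp add: if_distrib cong: if_cong)
    finally show "S $$ (i, j) = (S1 * J) $$ (i, j)" by simp
  qed (use S c in auto)
  then have "U * S * X = (U * S1 * J) * X"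
    by (simp only: assoc_mult_mat[OF U c])
  also have "\<dots> = (U * S1) * (J * X)"
    by (rule assoc_mult_mat[OF mult_carrier_mat[OF U c(1)] c(2) X])
  finally show ?thesis
    using rank_mult_le_inner_dim[OF mult_carrier_mat[OF U c(1)] mult_carrier_mat[OF c(2) X]]
    by (simp only:)
qed

lemma unitary_mat_cancel_left:
  assumes U: "unitary_mat n U" and X: "X \<in> carrier_mat n m"
  shows "mat_adjoint U * (U * X) = X"
proof -
  have Uc: "U \<in> carrier_mat n n" and UU: "mat_adjoint U * U = 1\<^sub>m n"
    using U by (auto simp: unitary_mat_def)
  have "mat_adjoint U * (U * X) = (mat_adjoint U * U) * X"
    by (rule assoc_mult_mat[OF mat_adjoint_carrier[OF Uc] Uc X, symmetric])
  also have "\<dots> = X"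
    unfolding UU using X by simp
  finally show ?thesis .
qed

text \<open>Dividing the hypothesis by \<open>c\<close> exhibits a left inverse of \<open>P\<close>;
  as \<open>P\<close> is square, it is also a right inverse.\<close>

lemma scaled_isometry_factor_invertible:
  fixes D P :: "complex mat"
  assumes D: "D \<in> carrier_mat m d" and P: "P \<in> carrier_mat d d"
    and iso: "mat_adjoint (D * P) * (D * P) = c \<cdot>\<^sub>m 1\<^sub>m d" and "c \<noteq> 0"
  obtains Q where "Q \<in> carrier_mat d d" "P * Q = 1\<^sub>m d"
proof -
  define Q where "Q = inverse c \<cdot>\<^sub>m (mat_adjoint (D * P) * D)"
  have F: "mat_adjoint (D * P) \<in> carrier_mat d m"
    by (rule mat_adjoint_carrier[OF mult_carrier_mat[OF D P]])
  have Q: "Q \<in> carrier_mat d d"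
    unfolding Q_def by (rule smult_carrier_mat[OF mult_carrier_mat[OF F D]])
  have "Q * P = inverse c \<cdot>\<^sub>m ((mat_adjoint (D * P) * D) * P)"
    unfolding Q_def by (rule mult_smult_assoc_mat[OF mult_carrier_mat[OF F D] P])
  also have "\<dots> = inverse c \<cdot>\<^sub>m (mat_adjoint (D * P) * (D * P))"
    by (simp only: assoc_mult_mat[OF F D P])
  also have "\<dots> = 1\<^sub>m d"
    unfolding iso using \<open>c \<noteq> 0\<close> by (intro eq_matI) auto
  finally have "P * Q = 1\<^sub>m d"
    by (rule mat_mult_left_right_inverse[OF Q P])
  with Q show thesis
    by (rule that)
qed

section \<open>Last right singular vectors and the null space\<close>

lemma last_right_singular_vectors_isometry:
  assumes "last_right_singular_vectors d A D" and A: "A \<in> carrier_mat n m" and "d \<le> m"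
  shows "D \<in> carrier_mat m d" "mat_adjoint D * D = 1\<^sub>m d"
proof -
  obtain V where V: "unitary_mat m V" and D: "D = mat m d (\<lambda>(i, j). V $$ (i, m - d + j))"
    using assms by (auto simp: last_right_singular_vectors_def is_svd_def)
  have Vc: "V \<in> carrier_mat m m"
    using V by (simp add: unitary_mat_def)
  have "D = V * tail_selector m d"
    unfolding D by (rule mult_tail_selector[OF Vc \<open>d \<le> m\<close>, symmetric])
  then show "mat_adjoint D * D = 1\<^sub>m d"
    by (simp only: mat_adjoint_tail_columns[OF V \<open>d \<le> m\<close>])
  show "D \<in> carrier_mat m d"
    by (simp add: D)
qed

text \<open>Because \<open>D = V * E\<close>, the factor \<open>V\<close> cancels and
  \<open>A * D = U * (S * E)\<close>; cancelling \<open>U\<close> leaves a question about the last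
  \<open>d\<close> columns of the diagonal matrix \<open>S\<close>.\<close>

lemma full_rank_annihilates_tail_iff:
  assumes sv: "last_right_singular_vectors d A D" and A: "A \<in> carrier_mat n m"
    and d: "1 \<le> d" "d \<le> m" and rank: "vec_space.rank n A = min n m"
  shows "A * D = 0\<^sub>m n d \<longleftrightarrow> n \<le> m - d"
proof -
  obtain U \<sigma> V where svd: "is_svd A U \<sigma> V" and D: "D = mat m d (\<lambda>(i, j). V $$ (i, m - d + j))"
    using sv A by (auto simp: last_right_singular_vectors_def)
  define S where "S = mat n m (\<lambda>(i, j). if i = j then complex_of_real (\<sigma> i) else 0)"
  define E where "E = tail_selector m d"
  have U: "unitary_mat n U" and V: "unitary_mat m V" and AS: "A = U * S * mat_adjoint V"
    using svd A by (auto simp: is_svd_def S_def)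
  have c: "U \<in> carrier_mat n n" "V \<in> carrier_mat m m" "S \<in> carrier_mat n m" "E \<in> carrier_mat m d"
    using U V by (auto simp: unitary_mat_def S_def E_def)
  have SE: "S * E = mat n d (\<lambda>(i, j). S $$ (i, m - d + j))"
    unfolding E_def by (rule mult_tail_selector[OF c(3) d(2)])
  have "D = V * E"
    unfolding D E_def by (rule mult_tail_selector[OF c(2) d(2), symmetric])
  then have "A * D = (U * S * mat_adjoint V) * (V * E)"
    by (simp only: AS)
  also have "\<dots> = (U * S) * (mat_adjoint V * (V * E))"
    by (rule assoc_mult_mat[OF mult_carrier_mat[OF c(1,3)] mat_adjoint_carrier[OF c(2)] mult_carrier_mat[OF c(2,4)]])
  also have "\<dots> = (U * S) * E"
    by (simp only: unitary_mat_cancel_left[OF V c(4)])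
  also have "\<dots> = U * (S * E)"
    by (rule assoc_mult_mat[OF c(1,3,4)])
  finally have AD: "A * D = U * (S * E)" .
  show ?thesis
  proof
    assume "A * D = 0\<^sub>m n d"
    then have "mat_adjoint U * (U * (S * E)) = 0\<^sub>m n d"
      unfolding AD by (simp only: right_mult_zero_mat[OF mat_adjoint_carrier[OF c(1)]])
    then have SE0: "S * E = 0\<^sub>m n d"
      unfolding unitary_mat_cancel_left[OF U mult_carrier_mat[OF c(3,4)]] .
    have zero: "S $$ (i, j) = 0" if "i < n" "m - d \<le> j" "j < m" for i j
    proof -
      have "(S * E) $$ (i, j - (m - d)) = S $$ (i, j)"
        unfolding SE using that d by simp
      then show ?thesis
        using SE0 that d by simp
    qed
    have "min n m \<le> m - d"
      using rank_mult_zero_tail_le[OF c(1) c(3) _ _ zero, of "mat_adjoint V" m] c rank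
      by (simp add: AS)
    \<comment> \<open>Since \<open>d \<ge> 1\<close>, the bound \<open>m - d\<close> is below
      \<open>m\<close>, so the minimum must be \<open>n\<close>.\<close>
    then show "n \<le> m - d"
      using d by linarith
  next
    assume "n \<le> m - d"
    \<comment> \<open>Each selected column has index at least \<open>m - d \<ge> n\<close>, hence
      beyond every row index and off the diagonal.\<close>
    then have "S * E = 0\<^sub>m n d"
      unfolding SE by (intro eq_matI) (auto simp: S_def)
    then show "A * D = 0\<^sub>m n d"
      using AD c by simp
  qed
qed

section \<open>Counting equations and variables\<close>

lemma alignment_proper_iff:
  assumes "1 \<le> K" "1 \<le> d" "d \<le> N"
  shows "alignment_proper K N d \<longleftrightarrow> K * d \<le> N"
proof -
  have "card ({1..K} - {k}) = K - 1" if "k \<in> {1..K}" for k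
    using that by simp
  then have "num_alignment_equations K d = K * ((K - 1) * (d * d))"
    by (simp add: num_alignment_equations_def matrix_equation_count_def)
  moreover have "num_alignment_variables K N d = K * (d * (N - d))"
    by (simp add: num_alignment_variables_def subspace_variable_count_def)
  ultimately have "alignment_proper K N d \<longleftrightarrow> d * ((K - 1) * d) \<le> d * (N - d)"
    using assms(1) by (simp add: alignment_proper_def ac_simps)
  also have "\<dots> \<longleftrightarrow> (K - 1) * d \<le> N - d"
    using assms(2) by simp
  \<comment> \<open>Adding \<open>d\<close> to both sides; \<open>K \<ge> 1\<close> and
    \<open>d \<le> N\<close> make the truncated subtractions exact.\<close>
  also have "\<dots> \<longleftrightarrow> K * d \<le> N"
    using assms by (cases K) auto
  finally show ?thesis .
qed

section \<open>Existence of precoders and feasibility\<close>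

lemma precoders_exist_iff:
  assumes "1 \<le> K" "1 \<le> d" "d \<le> M" "0 < Pt"
    and H: "\<And>l. l \<in> {1..K} \<Longrightarrow> H (K + 1) l \<in> carrier_mat Ne M"
    and rank: "\<And>l. l \<in> {1..K} \<Longrightarrow> vec_space.rank Ne (H (K + 1) l) = min Ne M"
    and sv: "\<And>l. l \<in> {1..K} \<Longrightarrow> last_right_singular_vectors d (H (K + 1) l) (\<Delta> l)"
  shows "(\<exists>F. zfws_precoders K M Ne d Pt H \<Delta> F) \<longleftrightarrow> Ne \<le> M - d"
proof
  assume "\<exists>F. zfws_precoders K M Ne d Pt H \<Delta> F"
  then obtain F where F: "zfws_precoders K M Ne d Pt H \<Delta> F" ..
  \<comment> \<open>All eavesdropper channels have the same size and rank, so a single user already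
    forces the inequality.\<close>
  have one: "1 \<in> {1..K}" using assms(1) by simp
  define A D where "A = H (K + 1) 1" and "D = \<Delta> 1"
  have A: "A \<in> carrier_mat Ne M" and svA: "last_right_singular_vectors d A D"
    using H[OF one] sv[OF one] by (simp_all add: A_def D_def)
  have D: "D \<in> carrier_mat M d"
    using last_right_singular_vectors_isometry[OF svA A assms(3)] by simp
  obtain P where P: "P \<in> carrier_mat d d" and
    iso: "mat_adjoint (D * P) * (D * P) = complex_of_real (Pt / real d) \<cdot>\<^sub>m 1\<^sub>m d" and
    zero: "A * (D * P) = 0\<^sub>m Ne d"
    using F one unfolding zfws_precoders_def A_def D_def by metis
  obtain Q where Q: "Q \<in> carrier_mat d d" "P * Q = 1\<^sub>m d"
    using scaled_isometry_factor_invertible[OF D P iso] assms by auto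
  \<comment> \<open>Inserting \<open>P * Q\<close> turns \<open>A * (D * P) = 0\<close> into
    \<open>A * D = 0\<close>.\<close>
  have "A * D = (A * D) * (P * Q)"
    unfolding Q(2) by (rule right_mult_one_mat[OF mult_carrier_mat[OF A D], symmetric])
  also have "\<dots> = (A * D) * P * Q"
    by (rule assoc_mult_mat[OF mult_carrier_mat[OF A D] P Q(1), symmetric])
  also have "(A * D) * P = A * (D * P)"
    by (rule assoc_mult_mat[OF A D P])
  finally have "A * D = 0\<^sub>m Ne d"
    unfolding zero using Q by simp
  then show "Ne \<le> M - d"
    using full_rank_annihilates_tail_iff[OF svA A assms(2,3)] rank[OF one] by (simp add: A_def)
next
  assume Ne: "Ne \<le> M - d"
  \<comment> \<open>The factor that gives the orthonormal columns of \<open>\<Delta> l\<close> the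
    prescribed power; the matching \<open>P\<close> is \<open>c\<close> times the identity.\<close>
  define c where "c = complex_of_real (sqrt (Pt / real d))"
  have cc: "cnj c * c = complex_of_real (Pt / real d)"
    using assms(4) by (simp add: c_def flip: of_real_mult)
  have "zfws_precoders K M Ne d Pt H \<Delta> (\<lambda>l. c \<cdot>\<^sub>m \<Delta> l)"
    unfolding zfws_precoders_def
  proof (intro ballI conjI)
    fix l assume l: "l \<in> {1..K}"
    note D = last_right_singular_vectors_isometry[OF sv[OF l] H[OF l] assms(3)]
    show "c \<cdot>\<^sub>m \<Delta> l \<in> carrier_mat M d"
      using D by simp
    have "mat_adjoint (c \<cdot>\<^sub>m \<Delta> l) * (c \<cdot>\<^sub>m \<Delta> l) = cnj c \<cdot>\<^sub>m (mat_adjoint (\<Delta> l) * (c \<cdot>\<^sub>m \<Delta> l))"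
      unfolding mat_adjoint_smult[OF D(1)]
      by (rule mult_smult_assoc_mat[OF mat_adjoint_carrier[OF D(1)] smult_carrier_mat[OF D(1)]])
    also have "mat_adjoint (\<Delta> l) * (c \<cdot>\<^sub>m \<Delta> l) = c \<cdot>\<^sub>m (mat_adjoint (\<Delta> l) * \<Delta> l)"
      using mult_smult_distrib[OF mat_adjoint_carrier[OF D(1)] D(1)] .
    also have "cnj c \<cdot>\<^sub>m \<dots> = (cnj c * c) \<cdot>\<^sub>m 1\<^sub>m d"
      unfolding D(2) by (intro eq_matI) auto
    finally show "mat_adjoint (c \<cdot>\<^sub>m \<Delta> l) * (c \<cdot>\<^sub>m \<Delta> l) = complex_of_real (Pt / real d) \<cdot>\<^sub>m 1\<^sub>m d"
      unfolding cc .
    have "H (K + 1) l * \<Delta> l = 0\<^sub>m Ne d"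
      using full_rank_annihilates_tail_iff[OF sv[OF l] H[OF l] assms(2,3) rank[OF l]] Ne by simp
    moreover have "H (K + 1) l * (c \<cdot>\<^sub>m \<Delta> l) = c \<cdot>\<^sub>m (H (K + 1) l * \<Delta> l)"
      by (rule mult_smult_distrib[OF H[OF l] D(1)])
    ultimately show "H (K + 1) l * (c \<cdot>\<^sub>m \<Delta> l) = 0\<^sub>m Ne d"
      by (auto intro!: eq_matI)
    show "\<exists>P\<in>carrier_mat d d. c \<cdot>\<^sub>m \<Delta> l = \<Delta> l * P"
      using D(1) by (intro bexI[of _ "c \<cdot>\<^sub>m 1\<^sub>m d"]) (auto simp: mult_smult_distrib[OF D(1)])
  qed
  then show "\<exists>F. zfws_precoders K M Ne d Pt H \<Delta> F"
    by (rule exI[where P = "zfws_precoders K M Ne d Pt H \<Delta>"])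
qed

text \<open>The two halves of feasibility decouple: existence of precoders yields the inequality on
  \<open>Ne\<close>, properness the one on \<open>N\<close>.\<close>

theorem theorem4:
  fixes K M N Ne d :: nat and Pt :: real
    and H :: "nat \<Rightarrow> nat \<Rightarrow> complex mat" and \<Delta> :: "nat \<Rightarrow> complex mat"
  assumes "K \<ge> 1" and "M \<ge> 1" and "N \<ge> 1" and "Ne \<ge> 1" and "d \<ge> 1"
    and "d \<le> min M N" and "Pt > 0"
    and "\<And>k l. k \<in> {1..K} \<Longrightarrow> l \<in> {1..K} \<Longrightarrow> H k l \<in> carrier_mat N M"
    and "\<And>l. l \<in> {1..K} \<Longrightarrow> H (K + 1) l \<in> carrier_mat Ne M"
    and "\<And>l. l \<in> {1..K} \<Longrightarrow> vec_space.rank Ne (H (K + 1) l) = min Ne M"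
    and "\<And>l. l \<in> {1..K} \<Longrightarrow> last_right_singular_vectors d (H (K + 1) l) (\<Delta> l)"
  shows "zfws_feasible K M N Ne d Pt H \<Delta> \<longleftrightarrow> M - d \<ge> Ne \<and> N \<ge> K * d"
proof -
  have "d \<le> M" "d \<le> N"
    using assms(6) by auto
  then show ?thesis
    unfolding zfws_feasible_def
    using alignment_proper_iff[OF assms(1,5)] precoders_exist_iff[where H = H and \<Delta> = \<Delta>, OF assms(1,5) \<open>d \<le> M\<close> assms(7,9,10,11)]
    by simp
qed

end
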